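(* Let $G$ be a graph with $n$ vertices and let $k$ be an integer with $1\le k\le n-1$. Define $$A_k := \max_{k^-<k}\left\{\frac{m_k-m_{k^-}}{k-k^-}\right\},\qquad B_k := \min_{k^+>k}\left\{\frac{m_{k^+}-m_k}{k^+-k}\right\},$$ where $k^-$ ranges over the integers with $0\le k^-<k$ and $k^+$ over the integers with $k<k^+\le n$. Then: (i) If $x_k$ is the incidence vector of a sparsest $k$-subgraph in $G$ and $\lambda\in\mathbb{R}$, then $x_k$ minimizes (SkS-L') with this $\lambda$ if and only if $A_k\le\lambda\le B_k$. (ii) Suppose $A_k<B_k$. If $x$ is an optimal solution of (SkS-L') with some $\lambda\in(A_k,B_k)$, then $x$ is the incidence vector of a sparsest $k$-subgraph in $G$.
   Context: Graphs are simple, undirected and finite, with vertex set $\{1,\dots,n\}$; the adjacency matrix of $G$ is denoted $A$ (not to be confused with the number $A_k$) and $e$ is the all-ones vector of length $n$. For $\ell\in\{0,1,\dots,n\}$, $m_\ell := \min\{\tfrac12 x^TAx \mid e^Tx=\ell,\ x\in\{0,1\}^n\}$ is the minimum number of edges in an induced subgraph of $G$ on $\ell$ vertices (so $m_0=m_1=0$). A sparsest $k$-subgraph is an induced subgraph on $k$ vertices with exactly $m_k$ edges; its incidence vector $x\in\{0,1\}^n$ has $x_i=1$ iff vertex $i$ belongs to the subgraph. For $\lambda\in\mathbb{R}$, the Lagrangian relaxation (up to an additive constant) is $$\text{(SkS-L')}\qquad \min\left\{\tfrac12 x^TAx-\lambda e^Tx \mid x\in\{0,1\}^n\right\}.$$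 *)

theory Defs
  imports "HOL-Analysis.Analysis"
begin

text \<open>The vertex set is a finite type \<open>'n\<close>, so that the number of vertices is \<open>CARD('n)\<close>;
  a graph is given by its set of edges, each edge being the set of its two end vertices.\<close>

definition simple_graph :: "'n::finite set set \<Rightarrow> bool" where
  "simple_graph E \<longleftrightarrow> (\<forall>e\<in>E. card e = 2)"

definition adjacency :: "'n::finite set set \<Rightarrow> real^'n^'n" where
  "adjacency E = (\<chi> i j. if {i, j} \<in> E then 1 else 0)"

definition binary_vecs :: "(real^'n::finite) set" where
  "binary_vecs = {x. \<forall>i. x $ i \<in> {0, 1}}"

text \<open>Below, \<open>1 :: real^'n\<close> is the all-ones vector.\<close>

definition min_edges :: "'n::finite set set \<Rightarrow> nat \<Rightarrow> real" where
  "min_edges E l = Min {1 / 2 * (x \<bullet> (adjacency E *v x)) | x.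
     1 \<bullet> x = real l \<and> x \<in> binary_vecs}"

definition induced_edges :: "'n::finite set set \<Rightarrow> 'n set \<Rightarrow> 'n set set" where
  "induced_edges E S = {e \<in> E. e \<subseteq> S}"

text \<open>An induced subgraph is identified with its vertex set \<open>S\<close>.\<close>

definition sparsest_subgraph :: "'n::finite set set \<Rightarrow> nat \<Rightarrow> 'n set \<Rightarrow> bool" where
  "sparsest_subgraph E k S \<longleftrightarrow>
     card S = k \<and> real (card (induced_edges E S)) = min_edges E k"

definition incidence_vec :: "'n::finite set \<Rightarrow> real^'n" where
  "incidence_vec S = (\<chi> i. if i \<in> S then 1 else 0)"

definition lagrangian_optimal ::
    "'n::finite set set \<Rightarrow> real \<Rightarrow> real^'n \<Rightarrow> bool" where
  "lagrangian_optimal E lam x \<longleftrightarrow>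
     is_arg_min (\<lambda>y. 1 / 2 * (y \<bullet> (adjacency E *v y)) - lam * (1 \<bullet> y))
       (\<lambda>y. y \<in> binary_vecs) x"

definition A_num :: "'n::finite set set \<Rightarrow> nat \<Rightarrow> real" where
  "A_num E k = Max ((\<lambda>j. (min_edges E k - min_edges E j) / (real k - real j)) ` {0..<k})"

definition B_num :: "'n::finite set set \<Rightarrow> nat \<Rightarrow> real" where
  "B_num E k =
     Min ((\<lambda>j. (min_edges E j - min_edges E k) / (real j - real k)) ` {k<..CARD('n)})"

end

theory Submission
  imports Defs
begin

text \<open>Grouping the feasible points of the relaxation by the number \<open>j\<close> of chosen vertices, a
  sparsest \<open>k\<close>-subgraph is optimal iff \<open>m\<^sub>k - \<lambda> k \<le> m\<^sub>j - \<lambda> j\<close> for all \<open>j\<close>. Solving for \<open>\<lambda>\<close> gives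
  the slopes in \<open>A\<^sub>k\<close> from \<open>j < k\<close> and those in \<open>B\<^sub>k\<close> from \<open>j > k\<close>; for \<open>\<lambda>\<close> strictly between the two,
  the inequality is strict for every \<open>j \<noteq> k\<close>.\<close>

lemma inner_one_incidence_vec: "1 \<bullet> incidence_vec S = real (card S)"
  by (simp add: inner_vec_def incidence_vec_def sum.If_cases)

text \<open>This allows every quantification over feasible vectors to be replaced by one over vertex
  sets.\<close>

lemma binary_vecs_eq_range: "binary_vecs = range incidence_vec"
proof
  show "binary_vecs \<subseteq> range incidence_vec"
  proof
    fix x :: "real^'n" assume "x \<in> binary_vecs"
    then have "\<forall>i. x $ i = 0 \<or> x $ i = 1"
      by (auto simp: binary_vecs_def)
    then have "x = incidence_vec {i. x $ i = 1}"
      by (auto simp: incidence_vec_def vec_eq_iff)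
    then show "x \<in> range incidence_vec"
      by blast
  qed
qed (auto simp: binary_vecs_def incidence_vec_def)

text \<open>An edge with end vertices \<open>a\<close> and \<open>b\<close> arises from exactly the
  two pairs \<open>(a, b)\<close> and \<open>(b, a)\<close>, distinct since
  \<open>a \<noteq> b\<close>, and different edges have disjoint sets of pairs.\<close>

lemma card_ordered_pairs_of_edges:
  fixes F :: "'n::finite set set"
  assumes "\<And>e. e \<in> F \<Longrightarrow> card e = 2"
  shows "card {(i, j). {i, j} \<in> F} = 2 * card F"
proof -
  have "card {(i, j). {i, j} = e} = 2" if "e \<in> F" for e
  proof -
    from assms[OF that] obtain a b where "e = {a, b}" "a \<noteq> b"
      unfolding card_2_iff by blast
    then have "{(i, j). {i, j} = e} = {(a, b), (b, a)}"
      by (auto simp: doubleton_eq_iff)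
    with \<open>a \<noteq> b\<close> show ?thesis by simp
  qed
  moreover have "{(i, j). {i, j} \<in> F} = (\<Union>e\<in>F. {(i, j). {i, j} = e})"
    by auto
  ultimately show ?thesis
    by (simp add: card_UN_disjoint disjoint_iff)
qed

text \<open>The form sums the adjacency entries over all ordered pairs from \<open>S\<close>, so
  each induced edge is counted twice, which the factor \<open>1 / 2\<close> undoes. Diagonal pairs
  contribute nothing, as a singleton is no edge.\<close>

lemma quadratic_form_incidence_vec:
  assumes "simple_graph E"
  shows "1 / 2 * (incidence_vec S \<bullet> (adjacency E *v incidence_vec S)) =
    real (card (induced_edges E S))"
proof -
  have "incidence_vec S \<bullet> (adjacency E *v incidence_vec S) =
      (\<Sum>i\<in>UNIV. \<Sum>j\<in>UNIV. if {i, j} \<in> induced_edges E S then 1 else 0)"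
    unfolding inner_vec_def matrix_vector_mult_def sum_distrib_left
    by (auto simp: incidence_vec_def adjacency_def induced_edges_def sum_distrib_left
        intro!: sum.cong)
  also have "\<dots> = (\<Sum>p\<in>UNIV. if {fst p, snd p} \<in> induced_edges E S then 1 else 0)"
    by (simp add: sum.cartesian_product case_prod_beta)
  also have "\<dots> = real (card {(i, j). {i, j} \<in> induced_edges E S})"
    by (simp add: sum.If_cases case_prod_unfold)
  also have "\<dots> = 2 * real (card (induced_edges E S))"
    using assms
    by (subst card_ordered_pairs_of_edges) (auto simp: simple_graph_def induced_edges_def)
  finally show ?thesis by simp
qed

lemma lagrangian_optimal_incidence_vec_iff:
  assumes "simple_graph E"
  shows "lagrangian_optimal E lam (incidence_vec S) \<longleftrightarrow>
    (\<forall>T. real (card (induced_edges E S)) - lam * real (card S)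
       \<le> real (card (induced_edges E T)) - lam * real (card T))"
proof -
  let ?f = "\<lambda>y. 1 / 2 * (y \<bullet> (adjacency E *v y)) - lam * (1 \<bullet> y)"
  have "lagrangian_optimal E lam (incidence_vec S) \<longleftrightarrow>
      (\<forall>T. ?f (incidence_vec S) \<le> ?f (incidence_vec T))"
    unfolding lagrangian_optimal_def is_arg_min_linorder binary_vecs_eq_range by blast
  then show ?thesis
    by (simp only: quadratic_form_incidence_vec[OF assms] inner_one_incidence_vec)
qed

text \<open>With the minimum taken over the image of a finite family of vertex sets,
  \<open>Min_le\<close> and \<open>Min_in\<close> become applicable.\<close>

lemma min_edges_eq_Min:
  assumes "simple_graph E"
  shows "min_edges E l = Min ((\<lambda>S. real (card (induced_edges E S))) ` {S. card S = l})"
proof -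
  have "{1 / 2 * (x \<bullet> (adjacency E *v x)) | x. 1 \<bullet> x = real l \<and> x \<in> binary_vecs} =
      (\<lambda>S. 1 / 2 * (incidence_vec S \<bullet> (adjacency E *v incidence_vec S))) ` {S. card S = l}"
    by (auto simp: binary_vecs_eq_range inner_one_incidence_vec)
  then show ?thesis
    unfolding min_edges_def by (simp only: quadratic_form_incidence_vec[OF assms])
qed

lemma min_edges_le_card_induced_edges:
  assumes "simple_graph E"
  shows "min_edges E (card S) \<le> real (card (induced_edges E S))"
  unfolding min_edges_eq_Min[OF assms] by (rule Min_le) auto

text \<open>The bound on \<open>l\<close> provides a vertex set of that size, so the minimum is over
  a nonempty finite set and is attained.\<close>

lemma sparsest_subgraph_exists:
  fixes E :: "'n::finite set set"
  assumes "simple_graph E" and "l \<le> CARD('n)"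
  shows "\<exists>S. sparsest_subgraph E l S"
proof -
  have "{S :: 'n set. card S = l} \<noteq> {}"
    using obtain_subset_with_card_n[OF assms(2)] by blast
  then have "min_edges E l \<in> (\<lambda>S. real (card (induced_edges E S))) ` {S. card S = l}"
    unfolding min_edges_eq_Min[OF assms(1)] by (intro Min_in) auto
  then show ?thesis
    by (auto simp: sparsest_subgraph_def)
qed

text \<open>Among the sets \<open>T\<close> of size \<open>j\<close> the tightest inequality comes
  from a sparsest one, which exists for every \<open>j \<le> CARD('n)\<close>; the others follow
  since \<open>min_edges\<close> is a lower bound.\<close>

lemma lagrangian_optimal_sparsest_iff:
  fixes E :: "'n::finite set set"
  assumes "simple_graph E" and "sparsest_subgraph E k S"
  shows "lagrangian_optimal E lam (incidence_vec S) \<longleftrightarrow>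
    (\<forall>j\<le>CARD('n). min_edges E k - lam * real k \<le> min_edges E j - lam * real j)"
    (is "_ \<longleftrightarrow> ?R")
proof -
  have "lagrangian_optimal E lam (incidence_vec S) \<longleftrightarrow>
    (\<forall>T. min_edges E k - lam * real k
       \<le> real (card (induced_edges E T)) - lam * real (card T))"
    using assms by (simp add: lagrangian_optimal_incidence_vec_iff sparsest_subgraph_def)
  also have "\<dots> \<longleftrightarrow> ?R"
  proof (intro iffI allI impI)
    fix j assume *: "\<forall>T. min_edges E k - lam * real k
       \<le> real (card (induced_edges E T)) - lam * real (card T)" and "j \<le> CARD('n)"
    then obtain T where "sparsest_subgraph E j T"
      using sparsest_subgraph_exists assms(1) by blast
    with *[rule_format, of T] show "min_edges E k - lam * real k \<le> min_edges E j - lam * real j"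
      by (simp add: sparsest_subgraph_def)
  next
    fix T :: "'n set" assume ?R
    then have "min_edges E k - lam * real k \<le> min_edges E (card T) - lam * real (card T)"
      by (simp add: card_mono)
    then show "min_edges E k - lam * real k
       \<le> real (card (induced_edges E T)) - lam * real (card T)"
      using min_edges_le_card_induced_edges[OF assms(1), of T] by linarith
  qed
  finally show ?thesis .
qed

text \<open>Each denominator \<open>real k - real j\<close> is positive and can be multiplied out;
  \<open>1 \<le> k\<close> makes the range of the maximum nonempty.\<close>

lemma A_num_le_iff:
  assumes "1 \<le> k"
  shows "A_num E k \<le> lam \<longleftrightarrow>
    (\<forall>j<k. min_edges E k - lam * real k \<le> min_edges E j - lam * real j)"
proof -
  have "A_num E k \<le> lam \<longleftrightarrow>
      (\<forall>j<k. (min_edges E k - min_edges E j) / (real k - real j) \<le> lam)"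
    unfolding A_num_def using assms by (subst Max_le_iff) auto
  then show ?thesis
    by (auto simp: pos_divide_le_eq algebra_simps)
qed

text \<open>The strict variant, needed for the second claim; it holds because a maximum over a
  finite set is attained.\<close>

lemma A_num_less_iff:
  assumes "1 \<le> k"
  shows "A_num E k < lam \<longleftrightarrow>
    (\<forall>j<k. min_edges E k - lam * real k < min_edges E j - lam * real j)"
proof -
  have "A_num E k < lam \<longleftrightarrow>
      (\<forall>j<k. (min_edges E k - min_edges E j) / (real k - real j) < lam)"
    unfolding A_num_def using assms by (subst Max_less_iff) auto
  then show ?thesis
    by (auto simp: pos_divide_less_eq algebra_simps)
qed

text \<open>For \<open>j > k\<close> the denominator has the opposite sign to the case
  \<open>j < k\<close>, so the same inequality now bounds \<open>lam\<close> from above.\<close>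

lemma le_B_num_iff:
  fixes E :: "'n::finite set set"
  assumes "k < CARD('n)"
  shows "lam \<le> B_num E k \<longleftrightarrow>
    (\<forall>j\<in>{k<..CARD('n)}. min_edges E k - lam * real k \<le> min_edges E j - lam * real j)"
proof -
  have "lam \<le> B_num E k \<longleftrightarrow>
      (\<forall>j\<in>{k<..CARD('n)}. lam \<le> (min_edges E j - min_edges E k) / (real j - real k))"
    unfolding B_num_def using assms by (subst Min_ge_iff) auto
  then show ?thesis
    by (auto simp: pos_le_divide_eq algebra_simps)
qed

lemma less_B_num_iff:
  fixes E :: "'n::finite set set"
  assumes "k < CARD('n)"
  shows "lam < B_num E k \<longleftrightarrow>
    (\<forall>j\<in>{k<..CARD('n)}. min_edges E k - lam * real k < min_edges E j - lam * real j)"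
proof -
  have "lam < B_num E k \<longleftrightarrow>
      (\<forall>j\<in>{k<..CARD('n)}. lam < (min_edges E j - min_edges E k) / (real j - real k))"
    unfolding B_num_def using assms by (subst Min_gr_iff) auto
  then show ?thesis
    by (auto simp: pos_less_divide_eq algebra_simps)
qed

theorem theorem12:
  fixes E :: "'n::finite set set" and k :: nat
  assumes "simple_graph E"
    and "1 \<le> k" and "k \<le> CARD('n) - 1"
  shows "(\<forall>S lam. sparsest_subgraph E k S \<longrightarrow>
            (lagrangian_optimal E lam (incidence_vec S) \<longleftrightarrow>
               A_num E k \<le> lam \<and> lam \<le> B_num E k))
       \<and> (A_num E k < B_num E k \<longrightarrow>
            (\<forall>x. \<forall>lam\<in>{A_num E k<..<B_num E k}. lagrangian_optimal E lam x \<longrightarrow>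
               (\<exists>S. sparsest_subgraph E k S \<and> x = incidence_vec S)))"
proof (intro conjI allI impI ballI)
  have k: "k < CARD('n)"
    using assms(2,3) by linarith
  fix S lam assume "sparsest_subgraph E k S"
  then have "lagrangian_optimal E lam (incidence_vec S) \<longleftrightarrow>
      (\<forall>j\<le>CARD('n). min_edges E k - lam * real k \<le> min_edges E j - lam * real j)"
    using assms(1) by (rule lagrangian_optimal_sparsest_iff[rotated])
  also have "\<dots> \<longleftrightarrow> A_num E k \<le> lam \<and> lam \<le> B_num E k"
  proof -
    \<comment> \<open>The index \<open>j = k\<close> occurs in neither range of slopes, but its
      inequality is an instance of reflexivity.\<close>
    have split: "(\<forall>j\<le>CARD('n). P j) \<longleftrightarrow> (\<forall>j<k. P j) \<and> (\<forall>j\<in>{k<..CARD('n)}. P j)"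
      if "P k" for P :: "nat \<Rightarrow> bool"
    proof -
      have "j \<le> CARD('n) \<longleftrightarrow> j < k \<or> j = k \<or> j \<in> {k<..CARD('n)}" for j
        using k by auto
      with that show ?thesis by blast
    qed
    show ?thesis
      unfolding A_num_le_iff[OF assms(2)] le_B_num_iff[OF k]
      by (rule split) (rule order.refl)
  qed
  finally show "lagrangian_optimal E lam (incidence_vec S) \<longleftrightarrow>
      A_num E k \<le> lam \<and> lam \<le> B_num E k" .
next
  have k: "k < CARD('n)"
    using assms(2,3) by linarith
  fix x lam
  assume lam: "lam \<in> {A_num E k<..<B_num E k}" and opt: "lagrangian_optimal E lam x"
  then have "x \<in> binary_vecs"
    by (simp add: lagrangian_optimal_def is_arg_min_linorder)
  then obtain S where x: "x = incidence_vec S"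
    by (auto simp: binary_vecs_eq_range)
  obtain T where "sparsest_subgraph E k T"
    using sparsest_subgraph_exists[OF assms(1)] k by (meson less_imp_le_nat)
  \<comment> \<open>The optimal \<open>S\<close> is compared with a sparsest
    \<open>k\<close>-subgraph \<open>T\<close>, whose objective value is the right-hand
    side.\<close>
  then have le: "real (card (induced_edges E S)) - lam * real (card S)
      \<le> min_edges E k - lam * real k"
    using opt unfolding x lagrangian_optimal_incidence_vec_iff[OF assms(1)]
    by (metis sparsest_subgraph_def)
  have strict: "min_edges E k - lam * real k < min_edges E j - lam * real j"
    if "j \<noteq> k" "j \<le> CARD('n)" for j
  proof (cases "j < k")
    case True
    with lam show ?thesis
      using A_num_less_iff[OF assms(2), of E lam] by simp
  next
    case False
    with lam that show ?thesis
      using less_B_num_iff[OF k, of lam E] by simp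
  qed
  have ge: "min_edges E (card S) \<le> real (card (induced_edges E S))"
    using assms(1) by (rule min_edges_le_card_induced_edges)
  \<comment> \<open>Any other size would place the objective value of \<open>S\<close> strictly
    above that of \<open>T\<close>, by \<open>strict\<close> and \<open>ge\<close>, against
    \<open>le\<close>.\<close>
  have "card S = k"
  proof (rule ccontr)
    assume "card S \<noteq> k"
    then have "min_edges E k - lam * real k < min_edges E (card S) - lam * real (card S)"
      by (rule strict) (simp add: card_mono)
    with le ge show False by linarith
  qed
  \<comment> \<open>For \<open>card S = k\<close> the terms in \<open>lam\<close> cancel, and
    \<open>le\<close> and \<open>ge\<close> force the edge count to equal
    \<open>min_edges E k\<close>.\<close>
  with le ge x show "\<exists>S. sparsest_subgraph E k S \<and> x = incidence_vec S"
    by (auto simp: sparsest_subgraph_def)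
qed

end
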